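(* Let $N \ge 1$, let $A, B \in \mathbb{R}^{N \times N}$ be constant real matrices, and consider the single-input bilinear control system $$\dot z = A z + u\, B z, \qquad z(t) \in \mathbb{R}^N,\ u(t) \in \mathbb{R}.$$ This system is quadratic stabilizable if and only if there exists an $N \times N$ (real) symmetric positive definite matrix $P$ such that for all non-zero $z \in \mathbb{R}^N$ with $z^\top (PA + A^\top P) z \ge 0$, we have $z^\top (PB + B^\top P) z \ne 0$.
   Context: Control Lyapunov function (CLF): for a single-input control-affine system $\dot z = f(z) + g(z) u$ with $z \in \mathbb{R}^N$, $u \in \mathbb{R}$, and $f, g : \mathbb{R}^N \to \mathbb{R}^N$ continuously differentiable with $f(0) = 0$, let $\mathcal{D} \subset \mathbb{R}^N$ be a neighborhood containing the equilibrium $z = 0$. A CLF is a continuously differentiable positive definite function $V : \mathcal{D} \to \mathbb{R}_+$ such that for all $z \in \mathcal{D} \setminus \{0\}$, $$\inf_{u \in \mathbb{R}} \left[ \frac{\partial V}{\partial z} \cdot f(z) + \frac{\partial V}{\partial z} \cdot g(z)\, u \right] < 0$$ (the infimum may be $-\infty$). For the bilinear system, $f(z) = A z$ and $g(z) = B z$. Quadratic stabilizable: the bilinear system $\dot z = Az + uBz$ is called quadratic stabilizable if there exists a quadratic CLF for it, i.e. a CLF of the form $V(z) = z^\top P z$ that is a quadratic positive definite function (with $P$ a real symmetric positive definite $N \times N$ matrix). *)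

theory Defs
  imports "HOL-Analysis.Analysis"
begin

text \<open>Continuous differentiability, intended for open S: the derivative is continuous with
  respect to the operator norm.\<close>

definition C1_on :: "'a::real_normed_vector set \<Rightarrow> ('a \<Rightarrow> 'b::real_normed_vector) \<Rightarrow> bool" where
  "C1_on S h \<longleftrightarrow>
     (\<exists>h'. (\<forall>x\<in>S. (h has_derivative blinfun_apply (h' x)) (at x)) \<and> continuous_on S h')"

definition control_affine_system ::
    "(real^'n \<Rightarrow> real^'n) \<Rightarrow> (real^'n \<Rightarrow> real^'n) \<Rightarrow> bool" where
  "control_affine_system f g \<longleftrightarrow> C1_on UNIV f \<and> C1_on UNIV g \<and> f 0 = 0"

definition positive_definite_on :: "(real^'n) set \<Rightarrow> (real^'n \<Rightarrow> real) \<Rightarrow> bool" where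
  "positive_definite_on D V \<longleftrightarrow> V 0 = 0 \<and> (\<forall>z\<in>D - {0}. V z > 0)"

text \<open>Control Lyapunov functions for z' = f z + u g z.  The neighborhood D of the equilibrium
  is taken to be open, so that the derivative of V is determined at every point of D by V on D.
  The product of the row vector dV/dz with a vector w is the Frechet derivative of V at z applied
  to w.  The infimum is taken in the extended reals because it may be minus infinity.\<close>

definition control_lyapunov_function ::
    "(real^'n \<Rightarrow> real^'n) \<Rightarrow> (real^'n \<Rightarrow> real^'n) \<Rightarrow> (real^'n) set \<Rightarrow> (real^'n \<Rightarrow> real) \<Rightarrow> bool" where
  "control_lyapunov_function f g D V \<longleftrightarrow>
     control_affine_system f g \<and> open D \<and> 0 \<in> D \<and>
     C1_on D V \<and> positive_definite_on D V \<and>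
     (\<forall>z\<in>D - {0}.
        (INF u::real. ereal (frechet_derivative V (at z) (f z)
                           + frechet_derivative V (at z) (g z) * u)) < 0)"

definition sym_pos_def :: "real^'n^'n \<Rightarrow> bool" where
  "sym_pos_def P \<longleftrightarrow> transpose P = P \<and> (\<forall>z. z \<noteq> 0 \<longrightarrow> z \<bullet> (P *v z) > 0)"

definition quadratic_stabilizable :: "real^'n^'n \<Rightarrow> real^'n^'n \<Rightarrow> bool" where
  "quadratic_stabilizable A B \<longleftrightarrow>
     (\<exists>D P. sym_pos_def P \<and>
        control_lyapunov_function (\<lambda>z. A *v z) (\<lambda>z. B *v z) D (\<lambda>z. z \<bullet> (P *v z)))"

end

theory Submission
  imports Defs
begin

text \<open>
  Along the field \<open>M z\<close> the derivative of \<open>V z = z \<bullet> P z\<close> is the quadratic form of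
  \<open>P M + M\<^sup>T P\<close>.  An affine function of \<open>u\<close> has negative infimum iff its slope is nonzero or its
  constant term is negative, which is the stated condition at each point.  Being homogeneous, the
  condition holds everywhere as soon as it holds near \<open>0\<close>.
\<close>

lemma Inf_affine_less_0_iff:
  fixes a b :: real
  shows "(INF u::real. ereal (a + b * u)) < 0 \<longleftrightarrow> (a \<ge> 0 \<longrightarrow> b \<noteq> 0)"
proof -
  have "(INF u::real. ereal (a + b * u)) < 0 \<longleftrightarrow> (\<exists>u. a + b * u < 0)"
    by (simp add: Inf_less_iff)
  also have "\<dots> \<longleftrightarrow> (a \<ge> 0 \<longrightarrow> b \<noteq> 0)"
  proof (cases "b = 0")
    case False
    \<comment> \<open>The witness solves \<open>a + b * u = - 1\<close>.\<close>
    then have "a + b * ((- a - 1) / b) < 0" by simp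
    with False show ?thesis by blast
  qed auto
  finally show ?thesis .
qed

lemma inner_matrix_symmetric:
  fixes P :: "real^'n^'n"
  assumes "transpose P = P"
  shows "x \<bullet> (P *v y) = y \<bullet> (P *v x)"
proof -
  have "x \<bullet> (P *v y) = (transpose P *v x) \<bullet> y"
    unfolding transpose_matrix_vector dot_lmul_matrix ..
  then show ?thesis
    by (simp only: assms inner_commute)
qed

text \<open>Each of the two summands contributes \<open>(P *v z) \<bullet> (M *v z)\<close>: the
  first by symmetry of \<open>P\<close>, the second by moving \<open>transpose M\<close> across the
  inner product. The right-hand side is the shape in which the derivative of the quadratic form
  appears.\<close>

lemma inner_Lyapunov_matrix:
  fixes P M :: "real^'n^'n"
  assumes "transpose P = P"
  shows "z \<bullet> ((P ** M + transpose M ** P) *v z) = 2 * ((P *v z) \<bullet> (M *v z))"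
proof -
  have "z \<bullet> (P *v (M *v z)) = (P *v z) \<bullet> (M *v z)"
    unfolding inner_matrix_symmetric[OF assms, of z] by (rule inner_commute)
  moreover have "z \<bullet> (transpose M *v (P *v z)) = (P *v z) \<bullet> (M *v z)"
    unfolding transpose_matrix_vector by (simp only: inner_commute[of z] dot_lmul_matrix)
  ultimately show ?thesis
    by (simp add: matrix_vector_mult_add_rdistrib inner_add_right
        flip: matrix_vector_mul_assoc)
qed

lemma quadratic_form_has_derivative:
  fixes P :: "real^'n^'n"
  assumes "transpose P = P"
  shows "((\<lambda>z. z \<bullet> (P *v z)) has_derivative (\<lambda>w. 2 * ((P *v z) \<bullet> w))) (at z)"
proof -
  have "((\<lambda>z. P *v z) has_derivative (\<lambda>w. P *v w)) (at z)"
    by (rule bounded_linear_imp_has_derivative) simp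
  \<comment> \<open>The product rule gives
    \<open>z \<bullet> (P *v w) + w \<bullet> (P *v z)\<close>, and symmetry of \<open>P\<close>
    makes the two terms equal.\<close>
  from has_derivative_inner[OF has_derivative_ident this] show ?thesis
    by (rule has_derivative_eq_rhs)
      (simp add: fun_eq_iff inner_matrix_symmetric[OF assms, of z] inner_commute)
qed

text \<open>A linear map is its own derivative at every point, so the derivative is constant in the
  base point and hence continuous.\<close>

lemma C1_on_matrix_vector_mult:
  fixes M :: "real^'n^'n"
  shows "C1_on S (\<lambda>z. M *v z)"
  unfolding C1_on_def
  by (rule exI[of _ "\<lambda>_. Blinfun (\<lambda>z. M *v z)"])
    (simp add: bounded_linear_Blinfun_apply bounded_linear_imp_has_derivative)

lemma C1_on_quadratic_form:
  fixes P :: "real^'n^'n"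
  assumes "transpose P = P"
  shows "C1_on S (\<lambda>z. z \<bullet> (P *v z))"
  unfolding C1_on_def
proof (intro exI conjI ballI)
  \<comment> \<open>The inner product with the gradient \<open>2 *\<^sub>R (P *v z)\<close>. It
    depends linearly and boundedly on \<open>z\<close>, which gives continuity in the operator
    norm.\<close>
  let ?h' = "\<lambda>z. blinfun_inner_left (2 *\<^sub>R (P *v z))"
  show "((\<lambda>z. z \<bullet> (P *v z)) has_derivative blinfun_apply (?h' z)) (at z)" for z
    using quadratic_form_has_derivative[OF assms, of z]
    by (rule has_derivative_eq_rhs) (simp add: fun_eq_iff inner_commute)
  show "continuous_on S ?h'"
    by (intro continuous_intros bounded_linear.continuous_on matrix_vector_mul_bounded_linear
        bounded_linear_blinfun_inner_left)
qed

text \<open>The regularity and positivity clauses hold automatically for such a \<open>V\<close>,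
  leaving only the neighborhood and the pointwise condition. \<open>D\<close> stays arbitrary
  because one direction of the theorem is handed some \<open>D\<close> and the other chooses
  one.\<close>

lemma control_lyapunov_function_quadratic_iff:
  fixes A B P :: "real^'n^'n"
  assumes P: "sym_pos_def P"
  shows "control_lyapunov_function (\<lambda>z. A *v z) (\<lambda>z. B *v z) D (\<lambda>z. z \<bullet> (P *v z)) \<longleftrightarrow>
    open D \<and> 0 \<in> D \<and>
    (\<forall>z\<in>D - {0}. z \<bullet> ((P ** A + transpose A ** P) *v z) \<ge> 0
       \<longrightarrow> z \<bullet> ((P ** B + transpose B ** P) *v z) \<noteq> 0)"
proof -
  have sym: "transpose P = P"
    using P by (simp add: sym_pos_def_def)
  have "frechet_derivative (\<lambda>z. z \<bullet> (P *v z)) (at z) (M *v z) =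
      z \<bullet> ((P ** M + transpose M ** P) *v z)" for M :: "real^'n^'n" and z
    \<comment> \<open>Uniqueness of the derivative replaces the choice in
      \<open>frechet_derivative\<close> by the explicit formula.\<close>
    unfolding frechet_derivative_at[OF quadratic_form_has_derivative[OF sym], symmetric]
    by (simp add: inner_Lyapunov_matrix[OF sym])
  moreover have "positive_definite_on D (\<lambda>z. z \<bullet> (P *v z))"
    using P by (simp add: positive_definite_on_def sym_pos_def_def)
  ultimately show ?thesis
    by (simp add: control_lyapunov_function_def control_affine_system_def Inf_affine_less_0_iff
        C1_on_matrix_vector_mult C1_on_quadratic_form[OF sym])
qed

text \<open>As \<open>c\<close> decreases to 0, \<open>c *\<^sub>R z\<close> tends to 0 and so
  eventually lies in \<open>D\<close>; the one-sided limit supplies \<open>c > 0\<close>.\<close>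

lemma open_contains_multiple:
  fixes z :: "'a::real_normed_vector"
  assumes "open D" "0 \<in> D"
  obtains c :: real where "c > 0" "c *\<^sub>R z \<in> D"
proof -
  have "((\<lambda>c. c *\<^sub>R z) \<longlongrightarrow> 0 *\<^sub>R z) (at_right 0)"
    by (intro tendsto_intros)
  then have "\<forall>\<^sub>F c in at_right 0. c *\<^sub>R z \<in> D"
    using assms by (auto dest: topological_tendstoD)
  then have "\<forall>\<^sub>F c in at_right 0. c > 0 \<and> c *\<^sub>R z \<in> D"
    using eventually_at_right_less by (rule eventually_elim2) auto
  then show ?thesis
    using that eventually_happens'[OF trivial_limit_at_right_real] by blast
qed

lemma quadratic_form_scaleR:
  fixes M :: "real^'n^'n"
  shows "(c *\<^sub>R z) \<bullet> (M *v (c *\<^sub>R z)) = c\<^sup>2 * (z \<bullet> (M *v z))"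
  by (simp add: matrix_vector_mult_scaleR power2_eq_square)

theorem theorem2:
  fixes A B :: "real^'n^'n"
  shows "quadratic_stabilizable A B \<longleftrightarrow>
    (\<exists>P :: real^'n^'n. sym_pos_def P \<and>
       (\<forall>z. z \<noteq> 0 \<and> z \<bullet> ((P ** A + transpose A ** P) *v z) \<ge> 0
            \<longrightarrow> z \<bullet> ((P ** B + transpose B ** P) *v z) \<noteq> 0))"
proof
  assume "quadratic_stabilizable A B"
  then obtain D P where P: "sym_pos_def P"
    and "control_lyapunov_function (\<lambda>z. A *v z) (\<lambda>z. B *v z) D (\<lambda>z. z \<bullet> (P *v z))"
    unfolding quadratic_stabilizable_def by blast
  then have D: "open D" "0 \<in> D"
    and cond: "\<And>z. z \<in> D - {0} \<Longrightarrow> z \<bullet> ((P ** A + transpose A ** P) *v z) \<ge> 0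
       \<Longrightarrow> z \<bullet> ((P ** B + transpose B ** P) *v z) \<noteq> 0"
    unfolding control_lyapunov_function_quadratic_iff[OF P] by blast+
  have "z \<bullet> ((P ** B + transpose B ** P) *v z) \<noteq> 0"
    if "z \<noteq> 0" "z \<bullet> ((P ** A + transpose A ** P) *v z) \<ge> 0" for z
  proof -
    \<comment> \<open>Both forms scale by c^2, so the hypothesis passes from \<open>z\<close> to
      \<open>c *\<^sub>R z\<close> and the conclusion passes back; \<open>c > 0\<close> keeps the
      multiple nonzero.\<close>
    obtain c :: real where c: "c > 0" "c *\<^sub>R z \<in> D"
      using open_contains_multiple[OF D] .
    have "(c *\<^sub>R z) \<bullet> ((P ** A + transpose A ** P) *v (c *\<^sub>R z)) \<ge> 0"
      unfolding quadratic_form_scaleR using that by simp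
    moreover have "c *\<^sub>R z \<in> D - {0}"
      using c \<open>z \<noteq> 0\<close> by simp
    ultimately have "(c *\<^sub>R z) \<bullet> ((P ** B + transpose B ** P) *v (c *\<^sub>R z)) \<noteq> 0"
      by (intro cond)
    then show ?thesis
      unfolding quadratic_form_scaleR by simp
  qed
  with P show "\<exists>P. sym_pos_def P \<and>
       (\<forall>z. z \<noteq> 0 \<and> z \<bullet> ((P ** A + transpose A ** P) *v z) \<ge> 0
            \<longrightarrow> z \<bullet> ((P ** B + transpose B ** P) *v z) \<noteq> 0)"
    by blast
next
  assume "\<exists>P. sym_pos_def P \<and>
       (\<forall>z. z \<noteq> 0 \<and> z \<bullet> ((P ** A + transpose A ** P) *v z) \<ge> 0
            \<longrightarrow> z \<bullet> ((P ** B + transpose B ** P) *v z) \<noteq> 0)"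
  then obtain P where P: "sym_pos_def P"
    and "\<forall>z. z \<noteq> 0 \<and> z \<bullet> ((P ** A + transpose A ** P) *v z) \<ge> 0
            \<longrightarrow> z \<bullet> ((P ** B + transpose B ** P) *v z) \<noteq> 0"
    by blast
  \<comment> \<open>The condition is global here, so the whole space serves as the
    neighborhood.\<close>
  then have "control_lyapunov_function (\<lambda>z. A *v z) (\<lambda>z. B *v z) UNIV (\<lambda>z. z \<bullet> (P *v z))"
    unfolding control_lyapunov_function_quadratic_iff[OF P] by simp
  with P show "quadratic_stabilizable A B"
    unfolding quadratic_stabilizable_def by blast
qed

end
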